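(* Let $F$ be a Keller mapping which is not an automorphism of $\mathbb{C}^2$. Assume that $F$ satisfies the $Y$-degree condition. Then for all $R(X,Y)=(X^{-\alpha},X^{\beta}Y+X^{-\alpha}\phi(X))\in R_0(F)$ we have the identity $$H_R(G_R(X,Y))=X^{\beta-\alpha}S_R(X,Y).$$
   Context: A Keller mapping is $F=(P,Q)\in\mathbb{C}[X,Y]^2$ with $\det J_F\in\mathbb{C}^{\times}$ (a nonzero constant). The $Y$-degree condition is $\deg F=\deg_YP=\deg_YQ$, where $\deg F=\max(\deg P,\deg Q)$. A point $(a,b)\in\mathbb{C}^2$ is an asymptotic value of $F$ if it is a limiting value of $F$ along a smooth curve in $\mathbb{C}^2$ tending to infinity; $A(F)$ is the set of all asymptotic values of $F$, which is a plane algebraic curve when the Keller mapping $F$ is not an automorphism. $R_0(F)$ is a geometric basis of $F$: a finite non-empty set of rational non-polynomial mappings $R\in\mathbb{C}(X,Y)^2$, here of the form $R(X,Y)=(X^{-\alpha},X^{\beta}Y+X^{-\alpha}\phi(X))$, where (depending on $R$) $\alpha\in\mathbb{Z}^{+}$, $\beta\in\mathbb{Z}^{+}\cup\{0\}$, $\phi\in\mathbb{C}[X]$, $\deg\phi<\alpha+\beta$, and the gcd of the powers of $X$ that effectively appear in $X^{\alpha+\beta}Y+\phi(X)$ equals $1$, such that, with $\mathrm{sing}(R)=\{X=0\}$: (i) the cardinality of $R_0(F)$ equals the number of irreducible components of $A(F)$; (ii) for every $R\in R_0(F)$, $\{G_R(a,b)\mid(a,b)\in\mathrm{sing}(R)\}$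 is an irreducible component of $A(F)$ (the $R$-component); (iii) $A(F)=\bigcup_{R\in R_0(F)}\{G_R(a,b)\mid (a,b)\in\mathrm{sing}(R)\}$; (iv) for every $R\in R_0(F)$, $F\circ R$ (defined off $\mathrm{sing}(R)$) has a polynomial extension $G_R\in\mathbb{C}[X,Y]^2$ (the $R$-dual of $F$). For $R\in R_0(F)$, $H_R\in\mathbb{C}[X,Y]$ is an irreducible polynomial such that $H_R=0$ is the $R$-component of $A(F)$. The polynomial $S_R\in\mathbb{C}[X,Y]$ is defined by $(H_R\circ G_R)(X,Y)=X^{\gamma}S_R(X,Y)$ with $\gamma\in\mathbb{Z}^{+}$ and $S_R(0,Y)\not\equiv 0$ (all powers of $X$ are absorbed in $X^{\gamma}$); thus the identity asserts $\gamma=\beta-\alpha$. *)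

theory Defs
  imports "HOL-Analysis.Analysis" "HOL-Computational_Algebra.Computational_Algebra"
begin

text \<open>
  \<open>\<complex>[X, Y]\<close> is \<open>(\<complex>[X])[Y]\<close>: in \<open>p :: complex poly poly\<close> the outer variable is \<open>Y\<close>, the inner
  one is \<open>X\<close>, and \<open>coeff (coeff p j) i\<close> is the coefficient of \<open>X ^ i * Y ^ j\<close>. In particular
  \<open>degree p\<close> is the \<open>Y\<close>-degree.
\<close>

type_synonym bipoly = "complex poly poly"
type_synonym polymap = "bipoly \<times> bipoly"

abbreviation polyX :: bipoly where
  "polyX \<equiv> [:[:0, 1:]:]"

definition eval2 :: "bipoly \<Rightarrow> complex \<times> complex \<Rightarrow> complex" where
  "eval2 p z = poly (poly p [:snd z:]) (fst z)"

definition eval_map :: "polymap \<Rightarrow> complex \<times> complex \<Rightarrow> complex \<times> complex" where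
  "eval_map F z = (eval2 (fst F) z, eval2 (snd F) z)"

definition subst2 :: "bipoly \<Rightarrow> polymap \<Rightarrow> bipoly" where
  "subst2 p G = (\<Sum>j\<le>degree p. \<Sum>i\<le>degree (coeff p j).
     [:[:coeff (coeff p j) i:]:] * fst G ^ i * snd G ^ j)"

definition total_deg :: "bipoly \<Rightarrow> nat" where
  "total_deg p = Max (insert 0 {i + j |i j. coeff (coeff p j) i \<noteq> 0})"

definition dX :: "bipoly \<Rightarrow> bipoly" where
  "dX p = map_poly pderiv p"

definition dY :: "bipoly \<Rightarrow> bipoly" where
  "dY p = pderiv p"

definition jacobian :: "polymap \<Rightarrow> bipoly" where
  "jacobian F = dX (fst F) * dY (snd F) - dY (fst F) * dX (snd F)"

definition keller :: "polymap \<Rightarrow> bool" where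
  "keller F \<longleftrightarrow> (\<exists>c. c \<noteq> 0 \<and> jacobian F = [:[:c:]:])"

definition automorphism :: "polymap \<Rightarrow> bool" where
  "automorphism F \<longleftrightarrow>
     (\<exists>G. (\<forall>z. eval_map G (eval_map F z) = z) \<and> (\<forall>z. eval_map F (eval_map G z) = z))"

definition Y_degree_condition :: "polymap \<Rightarrow> bool" where
  "Y_degree_condition F \<longleftrightarrow>
     max (total_deg (fst F)) (total_deg (snd F)) = degree (fst F) \<and>
     degree (fst F) = degree (snd F)"

text \<open>A smooth curve is an infinitely differentiable map on \<open>[0, \<infinity>)\<close>; \<open>D n\<close> is its \<open>n\<close>-th derivative.\<close>

definition smooth_curve :: "(real \<Rightarrow> complex \<times> complex) \<Rightarrow> bool" where
  "smooth_curve c \<longleftrightarrow> (\<exists>D. D 0 = c \<and>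
     (\<forall>n. \<forall>t\<ge>0. (D n has_vector_derivative D (Suc n) t) (at t within {0..})))"

definition asymptotic_values :: "polymap \<Rightarrow> (complex \<times> complex) set" where
  "asymptotic_values F = {w. \<exists>c. smooth_curve c \<and> filterlim c at_infinity at_top \<and>
     ((\<lambda>t. eval_map F (c t)) \<longlongrightarrow> w) at_top}"

definition zero_set :: "bipoly \<Rightarrow> (complex \<times> complex) set" where
  "zero_set p = {z. eval2 p z = 0}"

definition algebraic_set :: "(complex \<times> complex) set \<Rightarrow> bool" where
  "algebraic_set Z \<longleftrightarrow> (\<exists>I. Z = {z. \<forall>p\<in>I. eval2 p z = 0})"

definition irreducible_algebraic_set :: "(complex \<times> complex) set \<Rightarrow> bool" where
  "irreducible_algebraic_set Z \<longleftrightarrow> algebraic_set Z \<and> Z \<noteq> {} \<and>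
     (\<forall>Z1 Z2. algebraic_set Z1 \<and> algebraic_set Z2 \<and> Z = Z1 \<union> Z2 \<longrightarrow> Z = Z1 \<or> Z = Z2)"

definition irreducible_components :: "(complex \<times> complex) set \<Rightarrow> (complex \<times> complex) set set" where
  "irreducible_components A = {Z. irreducible_algebraic_set Z \<and> Z \<subseteq> A \<and>
     (\<forall>Z'. irreducible_algebraic_set Z' \<and> Z \<subseteq> Z' \<and> Z' \<subseteq> A \<longrightarrow> Z' = Z)}"

text \<open>
  The rational mapping \<open>R(X, Y) = (X\<^sup>-\<^sup>\<alpha>, X\<^sup>\<beta> Y + X\<^sup>-\<^sup>\<alpha> \<phi>(X))\<close>. Its singular locus is \<open>X = 0\<close> when
  \<open>\<alpha> > 0\<close>; the value there is an artefact of \<open>inverse 0 = 0\<close> and is never used.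
\<close>

definition rat_map :: "nat \<Rightarrow> nat \<Rightarrow> complex poly \<Rightarrow> complex \<times> complex \<Rightarrow> complex \<times> complex" where
  "rat_map \<alpha> \<beta> \<phi> = (\<lambda>(x, y). (x powi (- int \<alpha>), x ^ \<beta> * y + x powi (- int \<alpha>) * poly \<phi> x))"

definition sing :: "(complex \<times> complex) set" where
  "sing = {0} \<times> UNIV"

definition X_exponents :: "bipoly \<Rightarrow> nat set" where
  "X_exponents p = {i. \<exists>j. coeff (coeff p j) i \<noteq> 0}"

text \<open>\<open>[:\<phi>, monom 1 (\<alpha> + \<beta>):]\<close> is \<open>X\<^sup>\<alpha>\<^sup>+\<^sup>\<beta> Y + \<phi>(X)\<close>.\<close>

definition admissible :: "nat \<Rightarrow> nat \<Rightarrow> complex poly \<Rightarrow> bool" where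
  "admissible \<alpha> \<beta> \<phi> \<longleftrightarrow> \<alpha> > 0 \<and> degree \<phi> < \<alpha> + \<beta> \<and>
     Gcd (X_exponents [:\<phi>, monom 1 (\<alpha> + \<beta>):]) = 1"

definition is_dual :: "polymap \<Rightarrow> (complex \<times> complex \<Rightarrow> complex \<times> complex) \<Rightarrow> polymap \<Rightarrow> bool" where
  "is_dual F R G \<longleftrightarrow> (\<forall>z. z \<notin> sing \<longrightarrow> eval_map G z = eval_map F (R z))"

definition dual :: "polymap \<Rightarrow> (complex \<times> complex \<Rightarrow> complex \<times> complex) \<Rightarrow> polymap" where
  "dual F R = (THE G. is_dual F R G)"

definition R_component ::
  "polymap \<Rightarrow> (complex \<times> complex \<Rightarrow> complex \<times> complex) \<Rightarrow> (complex \<times> complex) set" where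
  "R_component F R = eval_map (dual F R) ` sing"

definition geometric_basis ::
  "polymap \<Rightarrow> (complex \<times> complex \<Rightarrow> complex \<times> complex) set \<Rightarrow> bool" where
  "geometric_basis F R0 \<longleftrightarrow>
     finite R0 \<and> R0 \<noteq> {} \<and>
     (\<forall>R\<in>R0. \<exists>\<alpha> \<beta> \<phi>. admissible \<alpha> \<beta> \<phi> \<and> R = rat_map \<alpha> \<beta> \<phi>) \<and>
     (\<forall>R\<in>R0. \<exists>G. is_dual F R G) \<and>
     card R0 = card (irreducible_components (asymptotic_values F)) \<and>
     (\<forall>R\<in>R0. R_component F R \<in> irreducible_components (asymptotic_values F)) \<and>
     asymptotic_values F = (\<Union>R\<in>R0. R_component F R)"

lemma eval2_subst2: "eval2 (subst2 p G) z = eval2 p (eval_map G z)"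
proof -
  have c: "poly (coeff p j) x = (\<Sum>i\<le>degree (coeff p j). coeff (coeff p j) i * x ^ i)" for j x
    by (simp add: poly_altdef)
  have "eval2 p w = (\<Sum>j\<le>degree p. \<Sum>i\<le>degree (coeff p j). coeff (coeff p j) i * fst w ^ i * snd w ^ j)" for w
    unfolding eval2_def
    by (simp add: poly_altdef[of p] poly_sum c sum_distrib_right)
  then show ?thesis
    by (simp add: subst2_def eval_map_def) (simp add: eval2_def poly_sum mult.assoc)
qed

lemma eval2_eqI:
  assumes "\<And>x y. x \<noteq> 0 \<Longrightarrow> eval2 p (x, y) = eval2 q (x, y)"
  shows "p = q"
proof -
  have "poly (p - q) [:y:] = 0" for y
  proof (rule ccontr)
    let ?r = "poly (p - q) [:y:]"
    assume "?r \<noteq> 0"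
    then have "finite {x. poly ?r x = 0}"
      by (rule poly_roots_finite)
    moreover have "- {0} \<subseteq> {x. poly ?r x = 0}"
      using assms by (auto simp: eval2_def)
    ultimately have "finite (- {0 :: complex})"
      using finite_subset by blast
    then show False
      by (simp add: infinite_UNIV_char_0)
  qed
  then have "range (\<lambda>y. [:y:]) \<subseteq> {c. poly (p - q) c = 0}"
    by blast
  moreover have "infinite (range (\<lambda>y::complex. [:y:]))"
    by (metis finite_imageD infinite_UNIV_char_0 injI pCons_eq_iff)
  ultimately have "infinite {c. poly (p - q) c = 0}"
    using finite_subset by blast
  then have "p - q = 0"
    using poly_roots_finite by blast
  then show ?thesis by simp
qed

lemma dual_eqI:
  assumes "is_dual F R G"
  shows "dual F R = G"
  unfolding dual_def
proof (rule the_equality)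
  fix G' assume "is_dual F R G'"
  with assms show "G' = G"
    by (intro prod_eqI eval2_eqI) (auto simp: is_dual_def sing_def eval_map_def)
qed fact

end

theory Submission
  imports Defs "HOL-Computational_Algebra.Field_as_Ring"
begin

text \<open>
  Write \<open>G\<close> for the dual of \<open>F\<close> along \<open>R\<close>. The exponent \<open>\<gamma>\<close> is the order of vanishing of \<open>H \<circ> G\<close> along
  the line \<open>X = 0\<close>, and it can be read off from the Jacobian determinant of \<open>G\<close>, which is known
  exactly: away from \<open>X = 0\<close> it is \<open>det J\<^sub>F \<cdot> det J\<^sub>R\<close>, that is, a nonzero constant times
  \<open>X\<^sup>\<beta> / X\<^sup>\<alpha>\<^sup>+\<^sup>1\<close>.

  On the other hand, differentiating \<open>H \<circ> G = X\<^sup>\<gamma> S\<close> gives two linear equations for the two partial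
  derivatives of \<open>H\<close> at \<open>G\<close>, with matrix \<open>J\<^sub>G\<close>. Cramer's rule yields
  \<open>H\<^sub>u(G) \<cdot> det J\<^sub>G = (\<gamma> X\<^sup>\<gamma>\<^sup>-\<^sup>1 S + X\<^sup>\<gamma> S\<^sub>X) \<partial>\<^sub>Y G\<^sub>2 - X\<^sup>\<gamma> S\<^sub>Y \<partial>\<^sub>X G\<^sub>2\<close>,
  and symmetrically for \<open>H\<^sub>v\<close> with \<open>G\<^sub>1\<close>. The right-hand side vanishes to order exactly \<open>\<gamma> - 1\<close> as
  soon as \<open>\<partial>\<^sub>Y G\<^sub>2\<close> is not identically zero on \<open>X = 0\<close>, and the left-hand side to order exactly
  \<open>\<beta> - \<alpha> - 1\<close> as soon as \<open>H\<^sub>u \<circ> G\<close> is not. Comparing orders gives \<open>\<beta> = \<alpha> + \<gamma>\<close>.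

  Both nondegeneracy conditions come from the geometry of the curve \<open>H = 0\<close>, which \<open>G\<close> parametrizes
  by the line \<open>X = 0\<close>: because \<open>H\<close> is irreducible, its curve has infinitely many points at which the
  gradient is nonzero (lemma \<open>irreducible_infinitely_many_regular_zeros\<close>). Infinitely many points
  prevent the parametrization from being constant, and one regular point keeps
  the gradient from vanishing identically along it. They hold for matching components of \<open>G\<close> and of
  the gradient because the tangent vector of the parametrization is orthogonal to the gradient: if
  \<open>\<partial>\<^sub>Y G\<^sub>2\<close> is not identically zero on \<open>X = 0\<close> and \<open>H\<^sub>u \<circ> G\<close> were, then \<open>H\<^sub>v \<circ> G\<close> would be too.
\<close>

section \<open>Evaluation and partial derivatives of bivariate polynomials\<close>

lemma eval2_0 [simp]: "eval2 0 z = 0"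
  by (simp add: eval2_def)

lemma eval2_add [simp]: "eval2 (p + q) z = eval2 p z + eval2 q z"
  by (simp add: eval2_def)

lemma eval2_diff [simp]: "eval2 (p - q) z = eval2 p z - eval2 q z"
  by (simp add: eval2_def)

lemma eval2_mult [simp]: "eval2 (p * q) z = eval2 p z * eval2 q z"
  by (simp add: eval2_def)

lemma eval2_power [simp]: "eval2 (p ^ n) z = eval2 p z ^ n"
  by (simp add: eval2_def)

lemma eval2_pCons [simp]: "eval2 (pCons a p) z = poly a (fst z) + snd z * eval2 p z"
  by (simp add: eval2_def)

lemma dX_pCons [simp]: "dX (pCons a p) = pCons (pderiv a) (dX p)"
  unfolding dX_def by (rule map_poly_pCons) simp

lemma dX_0 [simp]: "dX 0 = 0"
  by (simp add: dX_def)

lemma dY_0 [simp]: "dY 0 = 0"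
  by (simp add: dY_def)

lemma dY_pCons [simp]: "dY (pCons a p) = p + pCons 0 (dY p)"
  by (simp add: dY_def pderiv_pCons)

lemma eval2_has_field_derivative_chain:
  assumes u: "(u has_field_derivative u') (at t)" and v: "(v has_field_derivative v') (at t)"
  shows "((\<lambda>t. eval2 p (u t, v t)) has_field_derivative
           eval2 (dX p) (u t, v t) * u' + eval2 (dY p) (u t, v t) * v') (at t)"
proof (induction p)
  case 0
  show ?case by simp
next
  case (pCons a p)
  have "((\<lambda>t. poly a (u t)) has_field_derivative poly (pderiv a) (u t) * u') (at t)"
    using DERIV_chain2[OF poly_DERIV u] .
  then have "((\<lambda>t. poly a (u t) + v t * eval2 p (u t, v t)) has_field_derivative
      poly (pderiv a) (u t) * u' + (v' * eval2 p (u t, v t) +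
       (eval2 (dX p) (u t, v t) * u' + eval2 (dY p) (u t, v t) * v') * v t)) (at t)"
    by (intro DERIV_add DERIV_mult v pCons.IH)
  then show ?case
    by (simp add: algebra_simps)
qed

lemma eval2_DERIV_fst:
  "((\<lambda>x. eval2 p (x, y)) has_field_derivative eval2 (dX p) (x, y)) (at x)"
  using eval2_has_field_derivative_chain[of "\<lambda>x. x" 1 x "\<lambda>_. y" 0 p] by simp

lemma eval2_DERIV_snd:
  "((\<lambda>y. eval2 p (x, y)) has_field_derivative eval2 (dY p) (x, y)) (at y)"
  using eval2_has_field_derivative_chain[of "\<lambda>_. x" 0 y "\<lambda>y. y" 1 p] by simp

lemma isCont_eval2_fst: "isCont (\<lambda>x. eval2 p (x, y)) x"
  using eval2_DERIV_fst by (rule DERIV_isCont)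

lemma subst2_partial_derivatives:
  shows "eval2 (dX (subst2 p G)) z =
           eval2 (dX p) (eval_map G z) * eval2 (dX (fst G)) z +
           eval2 (dY p) (eval_map G z) * eval2 (dX (snd G)) z" (is ?X)
    and "eval2 (dY (subst2 p G)) z =
           eval2 (dX p) (eval_map G z) * eval2 (dY (fst G)) z +
           eval2 (dY p) (eval_map G z) * eval2 (dY (snd G)) z" (is ?Y)
proof -
  obtain x y where z: "z = (x, y)" by (cases z)
  show ?X
    using DERIV_unique[OF eval2_DERIV_fst[of "subst2 p G" y x]]
      eval2_has_field_derivative_chain[OF eval2_DERIV_fst[of "fst G" y x] eval2_DERIV_fst[of "snd G" y x], of p]
    by (simp add: eval2_subst2 eval_map_def z)
  show ?Y
    using DERIV_unique[OF eval2_DERIV_snd[of "subst2 p G" x y]]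
      eval2_has_field_derivative_chain[OF eval2_DERIV_snd[of "fst G" x y] eval2_DERIV_snd[of "snd G" x y], of p]
    by (simp add: eval2_subst2 eval_map_def z)
qed

lemma partial_derivatives_polyX_power_mult:
  shows "eval2 (dX (polyX ^ n * p)) (x, y) =
           of_nat n * x ^ (n - 1) * eval2 p (x, y) + x ^ n * eval2 (dX p) (x, y)" (is ?X)
    and "eval2 (dY (polyX ^ n * p)) (x, y) = x ^ n * eval2 (dY p) (x, y)" (is ?Y)
proof -
  have "((\<lambda>x. x ^ n * eval2 p (x, y)) has_field_derivative
      of_nat n * x ^ (n - 1) * eval2 p (x, y) + x ^ n * eval2 (dX p) (x, y)) (at x)"
    by (rule derivative_eq_intros eval2_DERIV_fst refl | simp)+
  then show ?X
    using DERIV_unique[OF eval2_DERIV_fst[of "polyX ^ n * p" y x]] by simp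
  have "((\<lambda>y. x ^ n * eval2 p (x, y)) has_field_derivative x ^ n * eval2 (dY p) (x, y)) (at y)"
    by (rule derivative_eq_intros eval2_DERIV_snd refl | simp)+
  then show ?Y
    using DERIV_unique[OF eval2_DERIV_snd[of "polyX ^ n * p" x y]] by simp
qed

section \<open>Restriction to the line \<open>X = 0\<close>\<close>

lemma eval2_eq_poly_slice: "eval2 p (x, y) = poly (map_poly (\<lambda>a. poly a x) p) y"
  by (induction p) (simp_all add: map_poly_pCons)

lemma finite_zeros_on_vertical_line:
  assumes "eval2 p (x, y0) \<noteq> 0"
  shows "finite {y. eval2 p (x, y) = 0}"
  using assms unfolding eval2_eq_poly_slice by (intro poly_roots_finite) auto

lemma common_nonzero_on_vertical_line:
  assumes "eval2 p (x, y1) \<noteq> 0" and "eval2 q (x, y2) \<noteq> 0"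
  obtains y where "eval2 p (x, y) \<noteq> 0" and "eval2 q (x, y) \<noteq> 0"
proof -
  have "finite ({y. eval2 p (x, y) = 0} \<union> {y. eval2 q (x, y) = 0})"
    using assms by (auto intro: finite_zeros_on_vertical_line)
  then obtain y where "y \<notin> {y. eval2 p (x, y) = 0} \<union> {y. eval2 q (x, y) = 0}"
    using ex_new_if_finite infinite_UNIV_char_0 by blast
  then show thesis using that by blast
qed

lemma constant_on_vertical_line:
  assumes "\<And>y. eval2 (dY p) (x, y) = 0"
  shows "eval2 p (x, y) = eval2 p (x, 0)"
proof -
  have "\<exists>c. \<forall>y\<in>UNIV. eval2 p (x, y) = c"
    using eval2_DERIV_snd[of p x]
    by (intro has_field_derivative_zero_constant) (auto simp: assms)
  then show ?thesis by auto
qed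

text \<open>If the exponents differed, cancelling the smaller power and letting \<open>x\<close> tend to \<open>0\<close> would make
  \<open>u\<close> or \<open>v\<close> vanish at \<open>0\<close>.\<close>

lemma order_of_vanishing_unique:
  fixes u v :: "complex \<Rightarrow> complex"
  assumes eq: "\<And>x. x \<noteq> 0 \<Longrightarrow> x ^ m * u x = x ^ n * v x"
    and cont: "isCont u 0" "isCont v 0" and nz: "u 0 \<noteq> 0" "v 0 \<noteq> 0"
  shows "m = n"
proof -
  have not_less: "\<not> k < l"
    if eq: "\<And>x. x \<noteq> 0 \<Longrightarrow> x ^ k * f x = x ^ l * g x"
      and cont: "isCont f 0" "isCont g 0" and nz: "f 0 \<noteq> 0"
    for k l and f g :: "complex \<Rightarrow> complex"
  proof
    assume "k < l"
    have "f x = x ^ (l - k) * g x" if "x \<noteq> 0" for x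
    proof -
      have "x ^ k * f x = x ^ k * (x ^ (l - k) * g x)"
        using eq[OF that] \<open>k < l\<close> by (simp flip: power_add mult.assoc)
      with that show ?thesis by simp
    qed
    then have "\<forall>\<^sub>F x in at 0. x ^ (l - k) * g x = f x"
      by (simp add: eventually_at_filter)
    moreover have "((\<lambda>x. x ^ (l - k) * g x) \<longlongrightarrow> 0 ^ (l - k) * g 0) (at 0)"
      using cont by (intro tendsto_intros) (simp add: isCont_def)
    ultimately have "(f \<longlongrightarrow> 0 ^ (l - k) * g 0) (at 0)"
      by (rule Lim_transform_eventually[rotated])
    moreover have "(f \<longlongrightarrow> f 0) (at 0)"
      using cont by (simp add: isCont_def)
    ultimately have "f 0 = 0 ^ (l - k) * g 0"
      by (rule tendsto_unique[OF trivial_limit_at, rotated])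
    with \<open>k < l\<close> nz show False by simp
  qed
  show ?thesis
    using not_less[OF eq cont nz(1)] not_less[OF eq[symmetric] cont(2,1) nz(2)] by force
qed

section \<open>Regular points of an irreducible curve\<close>

text \<open>The nonzero member of least degree in the ideal generated by \<open>p\<close> and \<open>q\<close> divides \<open>p\<close> up to a
  factor from the coefficient ring, by pseudo-division. If \<open>p\<close> is prime, it must then divide either
  this member, which is too small, or the cofactor, which makes the member constant.\<close>

lemma prime_poly_bezout_const:
  fixes p q :: "'a :: idom poly"
  assumes prime: "prime_elem p" and q: "q \<noteq> 0" "degree q < degree p"
  obtains a b d where "d \<noteq> 0" and "a * p + b * q = [:d:]"
proof -
  define I where "I = {r. r \<noteq> 0 \<and> (\<exists>a b. r = a * p + b * q)}"
  have "q = 0 * p + 1 * q" by simp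
  with q have qI: "q \<in> I" unfolding I_def by blast
  obtain r where r: "r \<in> I" and min: "\<And>s. s \<in> I \<Longrightarrow> degree r \<le> degree s"
    using ex_has_least_nat[of "\<lambda>r. r \<in> I" q degree] qI by blast
  from r obtain a b where r0: "r \<noteq> 0" and rab: "r = a * p + b * q"
    by (auto simp: I_def)
  obtain t s where ts: "pseudo_divmod p r = (t, s)" by fastforce
  define c where "c = lead_coeff r ^ (Suc (degree p) - degree r)"
  have c0: "c \<noteq> 0" using r0 by (simp add: c_def)
  have div: "smult c p = r * t + s" and small: "s = 0 \<or> degree s < degree r"
    using pseudo_divmod[OF r0 ts] by (auto simp: c_def)
  have "s = ([:c:] - a * t) * p + (- b * t) * q"
    using div by (simp add: rab algebra_simps)
  then have "s = 0"
    using small min[of s] unfolding I_def by fastforce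
  with div have rt: "[:c:] * p = r * t" by simp
  have deg: "degree r < degree p"
    using min[OF qI] q by simp
  have "\<not> p dvd r"
    using dvd_imp_degree_le[of p r] r0 deg by auto
  moreover have "p dvd r * t"
    unfolding rt[symmetric] by (rule dvd_triv_right)
  ultimately have "p dvd t"
    using prime_elem_dvd_multD[OF prime] by blast
  then obtain w where w: "t = p * w" ..
  have "p * [:c:] = p * (r * w)"
    using rt w by (simp add: mult_ac)
  moreover have "p \<noteq> 0" using deg by auto
  ultimately have rw: "[:c:] = r * w" by (metis mult_cancel_left)
  then have "degree (r * w) = 0" by (metis degree_pCons_0)
  moreover have "r * w \<noteq> 0" using rw c0 by (metis pCons_eq_0_iff)
  ultimately have "degree r = 0" by (auto simp: degree_mult_eq)
  then obtain d where "r = [:d:]" by (rule degree_eq_zeroE)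
  with r0 rab show thesis
    by (intro that[of d a b]) auto
qed

text \<open>A curve \<open>H = 0\<close> of positive degree in \<open>Y\<close> has a point over every \<open>x\<close> outside a finite set, and
  a combination of \<open>H\<close> and \<open>H\<^sub>Y\<close> that depends on \<open>x\<close> only shows that \<open>H\<^sub>Y\<close> is nonzero there for all
  but finitely many further \<open>x\<close>. An irreducible \<open>H\<close> of degree \<open>0\<close> in \<open>Y\<close> is a vertical line with a
  simple equation.\<close>

lemma irreducible_infinitely_many_regular_zeros:
  assumes irr: "irreducible H"
  shows "infinite {z \<in> zero_set H. eval2 (dX H) z \<noteq> 0 \<or> eval2 (dY H) z \<noteq> 0}"
    (is "infinite ?Z")
proof (cases "degree H = 0")
  case True
  then obtain h where H: "H = [:h:]" by (rule degree_eq_zeroE)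
  have "h \<noteq> 0" "\<not> is_unit h"
    using irr by (auto simp: H irreducible_def is_unit_const_poly_iff)
  then have "degree h \<noteq> 0"
    by (metis is_unit_iff_degree)
  then obtain a where a: "poly h a = 0"
    using fundamental_theorem_of_algebra[of h] by (auto simp: constant_degree)
  then obtain k where k: "h = [:- a, 1:] * k"
    by (auto simp: poly_eq_0_iff_dvd elim: dvdE)
  have "H = [:[:- a, 1:]:] * [:k:]" by (simp add: H k)
  moreover have "\<not> is_unit [:[:- a, 1:]:]"
    by (simp add: is_unit_const_poly_iff is_unit_pCons_iff)
  ultimately have "is_unit [:k:]"
    using irreducibleD[OF irr] by blast
  then have "poly k a \<noteq> 0"
    by (auto simp: is_unit_const_poly_iff is_unit_poly_iff)
  then have "poly (pderiv h) a \<noteq> 0"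
    unfolding k pderiv_mult by (simp add: pderiv_pCons)
  with a have "Pair a ` UNIV \<subseteq> ?Z"
    by (auto simp: H zero_set_def)
  moreover have "infinite (Pair a ` (UNIV :: complex set))"
    by (auto dest!: finite_imageD simp: inj_on_def infinite_UNIV_char_0)
  ultimately show ?thesis using finite_subset by blast
next
  case False
  have "prime_elem H" using irr by (rule irreducible_imp_prime_elem)
  moreover have "dY H \<noteq> 0" "degree (dY H) < degree H"
    using False by (auto simp: dY_def pderiv_eq_0_iff degree_pderiv)
  ultimately obtain a b d where d0: "d \<noteq> 0" and d: "a * H + b * dY H = [:d:]"
    by (rule prime_poly_bezout_const)
  let ?E = "{x. poly (d * lead_coeff H) x = 0}"
  have "d * lead_coeff H \<noteq> 0" using d0 False by auto
  then have "finite ?E" by (rule poly_roots_finite)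
  then have "infinite (- ?E)"
    by (simp add: finite_compl infinite_UNIV_char_0 del: poly_mult lead_coeff_mult)
  moreover have "- ?E \<subseteq> fst ` ?Z"
  proof
    fix x assume x: "x \<in> - ?E"
    let ?h = "map_poly (\<lambda>a. poly a x) H"
    have "coeff ?h (degree H) \<noteq> 0"
      using x by (simp add: coeff_map_poly)
    then have "degree ?h \<noteq> 0"
      using False le_degree by fastforce
    then obtain y where "poly ?h y = 0"
      using fundamental_theorem_of_algebra[of ?h] by (auto simp: constant_degree)
    then have y: "eval2 H (x, y) = 0"
      by (simp add: eval2_eq_poly_slice)
    have "eval2 (a * H + b * dY H) (x, y) \<noteq> 0"
      unfolding d using x by simp
    with y have "(x, y) \<in> ?Z"
      by (auto simp: zero_set_def)
    then show "x \<in> fst ` ?Z" by force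
  qed
  ultimately show ?thesis
    using finite_subset finite_imageI by blast
qed

section \<open>The Jacobian determinant of the dual\<close>

text \<open>This is \<open>det J\<^sub>G = (det J\<^sub>F \<circ> R) \<cdot> det J\<^sub>R\<close>. As the first component of \<open>R\<close> depends on \<open>x\<close> only,
  \<open>det J\<^sub>R\<close> is the product of its diagonal entries \<open>- \<alpha> / x\<^sup>\<alpha>\<^sup>+\<^sup>1\<close> and \<open>x\<^sup>\<beta>\<close>.\<close>

lemma jacobian_dual:
  assumes jac: "jacobian F = [:[:c:]:]" and dual: "is_dual F (rat_map \<alpha> \<beta> \<phi>) G" and x: "x \<noteq> 0"
  shows "x ^ (\<alpha> + 1) * eval2 (jacobian G) (x, y) = - of_nat \<alpha> * c * x ^ \<beta>"
proof -
  define r where "r = (\<lambda>x::complex. x powi (- int \<alpha>))"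
  define s where "s = (\<lambda>x y. x ^ \<beta> * y + r x * poly \<phi> x)"
  define r' where "r' = - of_nat \<alpha> * x powi (- int \<alpha> - 1)"
  have G: "eval_map G (x, y) = eval_map F (r x, s x y)" if "x \<noteq> 0" for x y
    using dual that by (simp add: is_dual_def sing_def rat_map_def r_def s_def)
  have r': "(r has_field_derivative r') (at x)"
    unfolding r_def r'_def using x
    by (auto intro!: derivative_eq_intros)
  have "((\<lambda>x. s x y) has_field_derivative
      (of_nat \<beta> * x ^ (\<beta> - 1)) * y + (r' * poly \<phi> x + poly (pderiv \<phi>) x * r x)) (at x)"
    unfolding s_def
    by (rule derivative_eq_intros r' poly_DERIV refl | simp)+
  then obtain s' where s': "((\<lambda>x. s x y) has_field_derivative s') (at x)" by blast
  have sY: "((\<lambda>y. s x y) has_field_derivative x ^ \<beta>) (at y)"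
    unfolding s_def by (rule derivative_eq_intros refl | simp)+
  have dX_dY: "eval2 (dX q) (x, y) = eval2 (dX p) (r x, s x y) * r' + eval2 (dY p) (r x, s x y) * s' \<and>
      eval2 (dY q) (x, y) = eval2 (dY p) (r x, s x y) * x ^ \<beta>"
    if eq: "\<And>x y. x \<noteq> 0 \<Longrightarrow> eval2 q (x, y) = eval2 p (r x, s x y)" for p q
  proof
    have "((\<lambda>x. eval2 q (x, y)) has_field_derivative
        eval2 (dX p) (r x, s x y) * r' + eval2 (dY p) (r x, s x y) * s') (at x)"
      by (rule has_field_derivative_transform_within_open
          [OF eval2_has_field_derivative_chain[OF r' s'], of "- {0}"]) (use x eq in auto)
    then show "eval2 (dX q) (x, y) = eval2 (dX p) (r x, s x y) * r' + eval2 (dY p) (r x, s x y) * s'"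
      using DERIV_unique[OF eval2_DERIV_fst] by blast
    have "((\<lambda>y. eval2 q (x, y)) has_field_derivative eval2 (dY p) (r x, s x y) * x ^ \<beta>) (at y)"
      using eval2_has_field_derivative_chain[OF DERIV_const sY, of p "r x"] eq[OF x] by simp
    then show "eval2 (dY q) (x, y) = eval2 (dY p) (r x, s x y) * x ^ \<beta>"
      using DERIV_unique[OF eval2_DERIV_snd] by blast
  qed
  have fst: "eval2 (fst G) (x, y) = eval2 (fst F) (r x, s x y)"
   and snd: "eval2 (snd G) (x, y) = eval2 (snd F) (r x, s x y)" if "x \<noteq> 0" for x y
    using G[OF that] by (simp_all add: eval_map_def)
  have "eval2 (jacobian G) (x, y) = eval2 (jacobian F) (r x, s x y) * r' * x ^ \<beta>"
    using dX_dY[OF fst] dX_dY[OF snd] by (simp add: jacobian_def algebra_simps)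
  then have "x ^ (\<alpha> + 1) * eval2 (jacobian G) (x, y) = (x ^ (\<alpha> + 1) * r') * c * x ^ \<beta>"
    by (simp add: jac)
  moreover have "x ^ (\<alpha> + 1) * r' = - of_nat \<alpha>"
    using x by (simp add: r'_def power_int_diff power_int_minus field_simps)
  ultimately show ?thesis by metis
qed

text \<open>Both cases of Cramer's rule have this shape: \<open>W\<close> is one partial derivative of \<open>H\<close> along \<open>G\<close>,
  and \<open>B\<close> and \<open>C\<close> are, up to a common sign, the \<open>Y\<close>- and \<open>X\<close>-derivatives of the component of \<open>G\<close>
  that survives elimination. Cancelling \<open>J\<close> against the power of \<open>X\<close> leaves \<open>X\<^sup>\<beta> u = X\<^sup>\<alpha>\<^sup>+\<^sup>\<gamma> v\<close>, and at
  \<open>X = 0\<close> the factor \<open>v\<close> reduces to \<open>\<gamma> S B\<close>.\<close>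

lemma order_comparison:
  assumes cramer: "\<And>x y. eval2 W (x, y) * eval2 J (x, y) =
      eval2 (dX (polyX ^ \<gamma> * S)) (x, y) * eval2 B (x, y)
      - eval2 (dY (polyX ^ \<gamma> * S)) (x, y) * eval2 C (x, y)"
    and J: "\<And>x y. x \<noteq> 0 \<Longrightarrow> x ^ (\<alpha> + 1) * eval2 J (x, y) = k * x ^ \<beta>"
    and k: "k \<noteq> 0" and \<gamma>: "\<gamma> > 0"
    and S: "eval2 S (0, y1) \<noteq> 0" and B: "eval2 B (0, y2) \<noteq> 0" and W: "eval2 W (0, y3) \<noteq> 0"
  shows "\<beta> = \<alpha> + \<gamma>"
proof -
  obtain y4 where "eval2 (S * B) (0, y4) \<noteq> 0"
    using common_nonzero_on_vertical_line[OF S B] by auto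
  from common_nonzero_on_vertical_line[OF this W]
  obtain y where y: "eval2 S (0, y) \<noteq> 0" "eval2 B (0, y) \<noteq> 0" "eval2 W (0, y) \<noteq> 0"
    by auto
  define u where "u = (\<lambda>x. k * eval2 W (x, y))"
  define v where "v = (\<lambda>x. (of_nat \<gamma> * eval2 S (x, y) + x * eval2 (dX S) (x, y)) * eval2 B (x, y)
    - x * eval2 (dY S) (x, y) * eval2 C (x, y))"
  show ?thesis
  proof (rule order_of_vanishing_unique)
    fix x :: complex assume x: "x \<noteq> 0"
    obtain m where m: "\<gamma> = Suc m" using \<gamma> by (cases \<gamma>) auto
    have "x ^ \<beta> * u x = (x ^ (\<alpha> + 1) * eval2 J (x, y)) * eval2 W (x, y)"
      using J[OF x] by (simp add: u_def)
    also have "\<dots> = x ^ (\<alpha> + 1) * (eval2 W (x, y) * eval2 J (x, y))"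
      by (simp add: mult_ac)
    also have "\<dots> = x ^ (\<alpha> + \<gamma>) * v x"
      unfolding cramer partial_derivatives_polyX_power_mult v_def
      by (simp add: m power_add algebra_simps)
    finally show "x ^ \<beta> * u x = x ^ (\<alpha> + \<gamma>) * v x" .
  next
    show "isCont u 0" "isCont v 0"
      unfolding u_def v_def by (intro continuous_intros isCont_eval2_fst)+
    show "u 0 \<noteq> 0" "v 0 \<noteq> 0"
      using y k \<gamma> by (auto simp: u_def v_def)
  qed
qed

section \<open>The order of vanishing along the singular line\<close>

theorem theorem3p1:
  fixes F :: polymap
    and R0 :: "(complex \<times> complex \<Rightarrow> complex \<times> complex) set"
    and R :: "complex \<times> complex \<Rightarrow> complex \<times> complex"
    and \<alpha> \<beta> \<gamma> :: nat and \<phi> :: "complex poly" and H S :: bipoly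
  assumes "keller F"
    and "\<not> automorphism F"
    and "Y_degree_condition F"
    and "geometric_basis F R0"
    and "R \<in> R0" and "R = rat_map \<alpha> \<beta> \<phi>"
    and "irreducible H" and "zero_set H = R_component F R"
    and "\<gamma> > 0" and "subst2 H (dual F R) = polyX ^ \<gamma> * S" and "\<exists>y. eval2 S (0, y) \<noteq> 0"
  shows "\<alpha> \<le> \<beta> \<and> subst2 H (dual F R) = polyX ^ (\<beta> - \<alpha>) * S"
proof -
  obtain c where c: "c \<noteq> 0" "jacobian F = [:[:c:]:]"
    using assms(1) by (auto simp: keller_def)
  define G where "G = dual F R"
  have "is_dual F R G"
    using assms(4,5) dual_eqI unfolding geometric_basis_def G_def by blast
  then have J: "x ^ (\<alpha> + 1) * eval2 (jacobian G) (x, y) = (- of_nat \<alpha> * c) * x ^ \<beta>" if "x \<noteq> 0" for x y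
    using jacobian_dual[OF c(2) _ that] assms(6) by simp
  \<comment> \<open>The first component of \<open>R\<close> determines \<open>\<alpha>\<close>, so positivity carries over from the admissible
    presentation of \<open>R\<close>.\<close>
  obtain \<alpha>' \<beta>' \<phi>' where "admissible \<alpha>' \<beta>' \<phi>'" and R: "R = rat_map \<alpha>' \<beta>' \<phi>'"
    using assms(4,5) unfolding geometric_basis_def by blast
  then have "\<alpha>' > 0" by (simp add: admissible_def)
  have "rat_map \<alpha> \<beta> \<phi> (2, 0) = rat_map \<alpha>' \<beta>' \<phi>' (2, 0)"
    using assms(6) R by metis
  then have "(2::complex) ^ \<alpha> = 2 ^ \<alpha>'"
    by (simp add: rat_map_def power_int_minus)
  then have "norm (2::complex) ^ \<alpha> = norm (2::complex) ^ \<alpha>'"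
    by (metis norm_power)
  then have "\<alpha> > 0"
    using \<open>\<alpha>' > 0\<close> by simp
  with c have k: "- of_nat \<alpha> * c \<noteq> 0" by simp
  let ?U = "subst2 (dX H) G" and ?V = "subst2 (dY H) G"
  have HG: "polyX ^ \<gamma> * S = subst2 H G"
    using assms(10) by (simp add: G_def)
  have zeros: "zero_set H = (\<lambda>y. eval_map G (0, y)) ` UNIV"
    using assms(8) by (auto simp: R_component_def G_def sing_def)
  have regular: "infinite {z \<in> zero_set H. eval2 (dX H) z \<noteq> 0 \<or> eval2 (dY H) z \<noteq> 0}"
    using assms(7) by (rule irreducible_infinitely_many_regular_zeros)
  then have "{z \<in> zero_set H. eval2 (dX H) z \<noteq> 0 \<or> eval2 (dY H) z \<noteq> 0} \<noteq> {}"
    by (metis finite.emptyI)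
  then obtain y0 where y0: "eval2 ?U (0, y0) \<noteq> 0 \<or> eval2 ?V (0, y0) \<noteq> 0"
    unfolding zeros eval2_subst2 by blast
  \<comment> \<open>The image of the line \<open>X = 0\<close> lies in the curve, so its tangent vector is orthogonal to the gradient.\<close>
  have tangent: "eval2 ?U (0, y) * eval2 (dY (fst G)) (0, y) + eval2 ?V (0, y) * eval2 (dY (snd G)) (0, y) = 0" for y
    using subst2_partial_derivatives(2)[of H G "(0, y)", folded HG] \<open>\<gamma> > 0\<close>
    by (simp add: zero_power partial_derivatives_polyX_power_mult eval2_subst2)
  \<comment> \<open>Otherwise \<open>G\<close> would contract the line \<open>X = 0\<close>, and with it the whole curve, to a point.\<close>
  have "\<exists>y. eval2 (dY (fst G)) (0, y) \<noteq> 0 \<or> eval2 (dY (snd G)) (0, y) \<noteq> 0"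
  proof (rule ccontr)
    assume "\<not> ?thesis"
    then have "eval_map G (0, y) = eval_map G (0, 0)" for y
      using constant_on_vertical_line[of _ 0 y] by (simp add: eval_map_def)
    then have "zero_set H \<subseteq> {eval_map G (0, 0)}"
      unfolding zeros by blast
    then have "finite (zero_set H)" using finite_subset by blast
    with regular show False by simp
  qed
  then obtain y1 where y1: "eval2 (dY (fst G)) (0, y1) \<noteq> 0 \<or> eval2 (dY (snd G)) (0, y1) \<noteq> 0" ..
  obtain y2 where S: "eval2 S (0, y2) \<noteq> 0" using assms(11) ..
  note grad = subst2_partial_derivatives[of H G, folded HG eval2_subst2]
  have "\<beta> = \<alpha> + \<gamma>"
  proof (cases "eval2 (dY (snd G)) (0, y1) = 0")
    case False
    \<comment> \<open>If \<open>H\<^sub>u\<close> vanished along the line, tangency would make \<open>H\<^sub>v\<close> vanish as well.\<close>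
    have "\<exists>y. eval2 ?U (0, y) \<noteq> 0"
    proof (rule ccontr)
      assume U: "\<not> ?thesis"
      with y0 have "eval2 ?V (0, y0) \<noteq> 0" by simp
      from common_nonzero_on_vertical_line[OF this False] tangent U show False
        by (metis add_0 mult_eq_0_iff)
    qed
    then obtain y3 where "eval2 ?U (0, y3) \<noteq> 0" ..
    from order_comparison[OF _ J k \<open>\<gamma> > 0\<close> S False this, of "dX (snd G)"]
    show ?thesis
      unfolding grad by (simp add: jacobian_def algebra_simps)
  next
    case True
    with y1 have nz: "eval2 (- dY (fst G)) (0, y1) \<noteq> 0"
      by (simp add: eval2_def)
    have "\<exists>y. eval2 ?V (0, y) \<noteq> 0"
    proof (rule ccontr)
      assume V: "\<not> ?thesis"
      with y0 have "eval2 ?U (0, y0) \<noteq> 0" by simp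
      from common_nonzero_on_vertical_line[OF this] y1 True tangent V show False
        by (metis add.right_neutral mult_eq_0_iff)
    qed
    then obtain y3 where "eval2 ?V (0, y3) \<noteq> 0" ..
    from order_comparison[OF _ J k \<open>\<gamma> > 0\<close> S nz this, of "- dX (fst G)"]
    show ?thesis
      unfolding grad by (simp add: jacobian_def eval2_def algebra_simps)
  qed
  then show ?thesis
    using assms(10) by simp
qed

end
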